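(* Given any $\alpha>2$, there exist a non-trivial complex Banach space $X_\alpha$ and a power-bounded operator $T\in\mathcal{B}(X_\alpha)$ such that $\sigma(T)\cap\mathbb{T}=\{1\}$, $\|R(\mathrm{e}^{\mathrm{i}\theta},T)\|=O(|\theta|^{-\alpha})$ as $\theta\to0$, and $$\limsup_{n\to\infty}\|T^n(I-T)\|\left(\frac{n}{\log n}\right)^{1/\alpha}>0.$$
   Context: $T$ is power-bounded if $\sup_{n\geq0}\|T^n\|<\infty$; $\mathbb{T}$ is the unit circle; $R(\lambda,T)=(\lambda-T)^{-1}$. *)

theory Defs
  imports "HOL-Analysis.Analysis" "HOL-Library.Landau_Symbols" "HOL-Library.Liminf_Limsup"
begin

text \<open>Ambient space: \<open>l\<infinity>(\<nat>;\<complex>)\<close>, realised as bounded (automatically continuous)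
  functions \<open>nat \<Rightarrow>\<^sub>C complex\<close> with the sup norm.  A complex Banach space is
  represented as a closed complex-linear subspace of this ambient space.\<close>

type_synonym linf = "nat \<Rightarrow>\<^sub>C complex"

definition cscale :: "complex \<Rightarrow> linf \<Rightarrow> linf" where
  "cscale c f = Bcontfun (\<lambda>n. c * apply_bcontfun f n)"

definition csubspace :: "linf set \<Rightarrow> bool" where
  "csubspace X \<longleftrightarrow> 0 \<in> X \<and> (\<forall>x\<in>X. \<forall>y\<in>X. x + y \<in> X) \<and> (\<forall>c. \<forall>x\<in>X. cscale c x \<in> X)"

definition cbanach_subspace :: "linf set \<Rightarrow> bool" where
  "cbanach_subspace X \<longleftrightarrow> csubspace X \<and> closed X"

definition bounded_op :: "linf set \<Rightarrow> (linf \<Rightarrow> linf) \<Rightarrow> bool" where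
  "bounded_op X T \<longleftrightarrow> (\<forall>x\<in>X. T x \<in> X)
     \<and> (\<forall>x\<in>X. \<forall>y\<in>X. T (x + y) = T x + T y)
     \<and> (\<forall>c. \<forall>x\<in>X. T (cscale c x) = cscale c (T x))
     \<and> (\<exists>K. \<forall>x\<in>X. norm (T x) \<le> K * norm x)"

definition opnorm :: "linf set \<Rightarrow> (linf \<Rightarrow> linf) \<Rightarrow> real" where
  "opnorm X T = Sup ((\<lambda>x. norm (T x)) ` {x\<in>X. norm x \<le> 1})"

definition power_bounded :: "linf set \<Rightarrow> (linf \<Rightarrow> linf) \<Rightarrow> bool" where
  "power_bounded X T \<longleftrightarrow> (\<exists>M. \<forall>n. opnorm X (T ^^ n) \<le> M)"

definition lam_minus :: "complex \<Rightarrow> (linf \<Rightarrow> linf) \<Rightarrow> linf \<Rightarrow> linf" where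
  "lam_minus z T = (\<lambda>x. cscale z x - T x)"

definition is_inverse_on :: "linf set \<Rightarrow> (linf \<Rightarrow> linf) \<Rightarrow> (linf \<Rightarrow> linf) \<Rightarrow> bool" where
  "is_inverse_on X A S \<longleftrightarrow> bounded_op X S \<and> (\<forall>x\<in>X. S (A x) = x \<and> A (S x) = x)"

definition invertible_on :: "linf set \<Rightarrow> (linf \<Rightarrow> linf) \<Rightarrow> bool" where
  "invertible_on X A \<longleftrightarrow> (\<exists>S. is_inverse_on X A S)"

definition spectrum_on :: "linf set \<Rightarrow> (linf \<Rightarrow> linf) \<Rightarrow> complex set" where
  "spectrum_on X T = {z. \<not> invertible_on X (lam_minus z T)}"

text \<open>Resolvent \<open>R(\<lambda>,T) = (\<lambda> - T)\<^sup>-\<^sup>1\<close> (unique on X).\<close>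
definition resolvent :: "linf set \<Rightarrow> (linf \<Rightarrow> linf) \<Rightarrow> complex \<Rightarrow> linf \<Rightarrow> linf" where
  "resolvent X T z = (SOME S. is_inverse_on X (lam_minus z T) S)"

end

theory Submission
  imports Defs "HOL-Real_Asymp.Real_Asymp"
begin

text \<open>The operator is a direct sum of blocks, one for each \<open>\<theta> = e\<^sup>-\<^sup>j\<close>. The block is the rotated lazy shift
  \<open>e\<^sup>i\<^sup>\<theta> ((1 - p) + p \<Lambda>)\<close>, where \<open>\<Lambda>\<close> is the left shift, \<open>p = \<theta>/10\<close>, and the norm is equivalent to
  \<open>max (sup \<bar>f\<^sub>k\<bar>) (\<Sum> e\<^bsup>k/L\<^esup> \<bar>f\<^sub>k\<bar> / L)\<close> with \<open>L = \<theta>\<^bsup>1 - \<alpha>\<^esup>\<close>. It is a contraction for the latter norm.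
  The summability part makes \<open>\<Lambda>\<close> have a resolvent of norm at most \<open>L + 1\<close> up to the unit circle, so
  the resolvent of the block is \<open>O(L/p) = O(\<theta>\<^sup>-\<^sup>\<alpha>)\<close> near \<open>e\<^sup>i\<^sup>\<theta>\<close>; at points \<open>z\<close> with
  \<open>\<bar>z - 1\<bar> > 2\<theta>\<close> it is \<open>O(1/\<bar>z - 1\<bar>)\<close>, because the spectrum of the block lies within \<open>2p\<close> of \<open>e\<^sup>i\<^sup>\<theta>\<close>.
  On the other hand the indicator function of a window of width \<open>O(\<surd>m)\<close> around \<open>m = \<epsilon> L log L\<close> still has
  norm at most 1, since the weight there is only about \<open>L\<^bsup>\<epsilon> - 1\<^esup>\<close>. The \<open>n\<close>-th power with \<open>n p = m\<close>, that is
  \<open>n \<approx> \<theta>\<^sup>-\<^sup>\<alpha> log (1/\<theta>)\<close>, carries most of this window to the coordinate 0 by Chebyshev's inequality. Hence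
  \<open>\<parallel>T\<^sup>n(I - T)\<parallel> \<ge> c \<theta>\<close>, and \<open>\<theta>\<close> is of order \<open>(log n / n)\<^bsup>1/\<alpha>\<^esup>\<close>.\<close>

section \<open>Bounded sequences and sums over subsets\<close>

lemma in_bcontfun_nat_iff: "f \<in> bcontfun \<longleftrightarrow> (\<exists>B. \<forall>n::nat. cmod (f n) \<le> B)"
  by (force simp: bcontfun_def bounded_iff)

lemma cscale_apply [simp]: "apply_bcontfun (cscale c f) n = c * apply_bcontfun f n"
proof -
  have "cmod (c * apply_bcontfun f n) \<le> cmod c * norm f" for n
    by (simp add: norm_mult mult_left_mono norm_bounded)
  then have "(\<lambda>n. c * apply_bcontfun f n) \<in> bcontfun"
    using in_bcontfun_nat_iff by blast
  then show ?thesis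
    by (simp add: cscale_def Bcontfun_inverse)
qed

lemma norm_cscale: "norm (cscale c f) \<le> cmod c * norm f"
  by (rule norm_bound) (simp add: norm_mult mult_left_mono norm_bounded)

text \<open>Splitting \<open>A\<close> by the sign of \<open>a\<close> turns the absolute sum into
  two subset sums. This is how a weighted l1 norm is recovered from moduli of subset sums.\<close>

lemma sum_abs_le_subset_sums:
  fixes a :: "'a \<Rightarrow> real"
  assumes "finite A" "\<And>B. B \<subseteq> A \<Longrightarrow> \<bar>sum a B\<bar> \<le> C"
  shows "(\<Sum>k\<in>A. \<bar>a k\<bar>) \<le> 2 * C"
proof -
  define P where "P = {k\<in>A. 0 \<le> a k}"
  have "(\<Sum>k\<in>A. \<bar>a k\<bar>) = (\<Sum>k\<in>A - P. \<bar>a k\<bar>) + (\<Sum>k\<in>P. \<bar>a k\<bar>)"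
    by (rule sum.subset_diff) (use assms in \<open>auto simp: P_def\<close>)
  also have "(\<Sum>k\<in>P. \<bar>a k\<bar>) = sum a P"
    by (rule sum.cong) (auto simp: P_def)
  also have "(\<Sum>k\<in>A - P. \<bar>a k\<bar>) = - sum a (A - P)"
    unfolding sum_negf [symmetric] by (rule sum.cong) (auto simp: P_def)
  finally show ?thesis
    using assms(2)[of P] assms(2)[of "A - P"] by (auto simp: P_def)
qed

lemma sum_cmod_le_subset_sums:
  fixes a :: "'a \<Rightarrow> complex"
  assumes "finite A" "\<And>B. B \<subseteq> A \<Longrightarrow> cmod (sum a B) \<le> C"
  shows "(\<Sum>k\<in>A. cmod (a k)) \<le> 4 * C"
proof -
  have "(\<Sum>k\<in>A. cmod (a k)) \<le> (\<Sum>k\<in>A. \<bar>Re (a k)\<bar> + \<bar>Im (a k)\<bar>)"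
    by (intro sum_mono cmod_le)
  moreover have "(\<Sum>k\<in>A. \<bar>Re (a k)\<bar>) \<le> 2 * C"
  proof (rule sum_abs_le_subset_sums[OF assms(1)])
    fix B assume "B \<subseteq> A"
    then show "\<bar>\<Sum>k\<in>B. Re (a k)\<bar> \<le> C"
      using assms(2)[of B] abs_Re_le_cmod[of "sum a B"] by simp
  qed
  moreover have "(\<Sum>k\<in>A. \<bar>Im (a k)\<bar>) \<le> 2 * C"
  proof (rule sum_abs_le_subset_sums[OF assms(1)])
    fix B assume "B \<subseteq> A"
    then show "\<bar>\<Sum>k\<in>B. Im (a k)\<bar> \<le> C"
      using assms(2)[of B] abs_Im_le_cmod[of "sum a B"] by simp
  qed
  ultimately show ?thesis
    by (simp add: sum.distrib)
qed

text \<open>The norm of one block, the maximum of the sup norm and the weighted l1 norm, as a bound.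
  Finite sums express the l1 part without a summability condition.\<close>

definition seq_bdd :: "(nat \<Rightarrow> real) \<Rightarrow> (nat \<Rightarrow> complex) \<Rightarrow> real \<Rightarrow> bool" where
  "seq_bdd w f C \<longleftrightarrow> (\<forall>k. cmod (f k) \<le> C) \<and> (\<forall>A. finite A \<longrightarrow> (\<Sum>k\<in>A. w k * cmod (f k)) \<le> C)"

lemma seq_bddI:
  "(\<And>k. cmod (f k) \<le> C) \<Longrightarrow> (\<And>A. finite A \<Longrightarrow> (\<Sum>k\<in>A. w k * cmod (f k)) \<le> C) \<Longrightarrow> seq_bdd w f C"
  by (simp add: seq_bdd_def)

lemma seq_bddD1: "seq_bdd w f C \<Longrightarrow> cmod (f k) \<le> C"
  and seq_bddD2: "seq_bdd w f C \<Longrightarrow> finite A \<Longrightarrow> (\<Sum>k\<in>A. w k * cmod (f k)) \<le> C"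
  by (simp_all add: seq_bdd_def)

lemma seq_bdd_nonneg: "seq_bdd w f C \<Longrightarrow> 0 \<le> C"
  using seq_bddD1[of w f C 0] norm_ge_zero[of "f 0"] by linarith

lemma seq_bdd_mono: "seq_bdd w f C \<Longrightarrow> C \<le> D \<Longrightarrow> seq_bdd w f D"
  unfolding seq_bdd_def by (meson order_trans)

section \<open>Weighted direct sums inside the sequence space\<close>

locale weighted_blocks =
  fixes w :: "nat \<Rightarrow> nat \<Rightarrow> real"
  assumes w_pos: "0 < w j k"
begin

definition bdd :: "(nat \<Rightarrow> nat \<Rightarrow> complex) \<Rightarrow> real \<Rightarrow> bool" where
  "bdd f C \<longleftrightarrow> (\<forall>j. seq_bdd (w j) (f j) C)"

text \<open>Besides its coordinates, a block sequence is encoded by its weighted sums over all finite sets: the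
  largest of their moduli is the weighted \<open>l\<^sup>1\<close> norm up to a factor 4.\<close>

definition emb_fun :: "(nat \<Rightarrow> nat \<Rightarrow> complex) \<Rightarrow> nat \<Rightarrow> complex" where
  "emb_fun f n = (case prod_decode n of (j, s) \<Rightarrow> (case sum_decode s of
     Inl k \<Rightarrow> f j k | Inr a \<Rightarrow> (\<Sum>k\<in>set_decode a. of_real (w j k) * f j k)))"

definition emb :: "(nat \<Rightarrow> nat \<Rightarrow> complex) \<Rightarrow> linf" where
  "emb f = Bcontfun (emb_fun f)"

definition coord :: "linf \<Rightarrow> nat \<Rightarrow> nat \<Rightarrow> complex" where
  "coord g j k = apply_bcontfun g (prod_encode (j, sum_encode (Inl k)))"

text \<open>The range of \<open>emb\<close> on bounded arrays: the sequences whose entries are all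
  determined by their block coordinates.\<close>

definition X :: "linf set" where
  "X = {g. \<forall>n. apply_bcontfun g n = emb_fun (coord g) n}"

lemma emb_fun_lincomb: "emb_fun (\<lambda>j k. c * f j k + d * g j k) n = c * emb_fun f n + d * emb_fun g n"
  by (auto simp: emb_fun_def sum.distrib sum_distrib_left algebra_simps split: prod.split sum.split)

lemma emb_fun_add: "emb_fun (\<lambda>j k. f j k + g j k) n = emb_fun f n + emb_fun g n"
  using emb_fun_lincomb[of 1 f 1 g n] by simp

lemma emb_fun_mult: "emb_fun (\<lambda>j k. c * f j k) n = c * emb_fun f n"
  using emb_fun_lincomb[of c f 0 f n] by simp

lemma coord_add [simp]: "coord (x + y) = (\<lambda>j k. coord x j k + coord y j k)"
  and coord_diff [simp]: "coord (x - y) = (\<lambda>j k. coord x j k - coord y j k)"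
  and coord_cscale [simp]: "coord (cscale c x) = (\<lambda>j k. c * coord x j k)"
  and coord_0 [simp]: "coord 0 = (\<lambda>j k. 0)"
  by (simp_all add: coord_def fun_eq_iff)

lemma X_eqI: "x \<in> X \<Longrightarrow> y \<in> X \<Longrightarrow> coord x = coord y \<Longrightarrow> x = y"
  by (auto simp: X_def intro: bcontfun_eqI)

lemma csubspace_X: "csubspace X"
proof -
  have "emb_fun (\<lambda>j k. 0) n = 0" for n
    using emb_fun_mult[of 0] by simp
  then show ?thesis
    unfolding csubspace_def X_def by (auto simp: emb_fun_add emb_fun_mult)
qed

lemma X_diff: "x \<in> X \<Longrightarrow> y \<in> X \<Longrightarrow> x - y \<in> X"
  using emb_fun_lincomb[of 1 "coord x" "-1" "coord y"] by (auto simp: X_def)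

lemma X_cscale: "x \<in> X \<Longrightarrow> cscale c x \<in> X"
  and X_add: "x \<in> X \<Longrightarrow> y \<in> X \<Longrightarrow> x + y \<in> X"
  and X_0: "0 \<in> X"
  using csubspace_X by (auto simp: csubspace_def)

lemma continuous_on_eval: "continuous_on UNIV (\<lambda>g::linf. apply_bcontfun g n)"
proof (rule lipschitz_on_continuous_on)
  show "1-lipschitz_on UNIV (\<lambda>g::linf. apply_bcontfun g n)"
    by (rule lipschitz_onI) (auto simp: dist_bounded)
qed

text \<open>Every entry of \<open>emb_fun (coord g)\<close> is a finite combination of evaluations
  of \<open>g\<close>, so \<open>X\<close> is an intersection of equalizers of continuous
  functions.\<close>

lemma closed_X: "closed X"
proof -
  have "continuous_on UNIV (\<lambda>g. emb_fun (coord g) n)" for n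
    by (cases "prod_decode n"; cases "sum_decode (snd (prod_decode n))")
      (auto simp: emb_fun_def coord_def intro!: continuous_intros continuous_on_eval)
  then show ?thesis
    unfolding X_def by (intro closed_Collect_all closed_Collect_eq continuous_on_eval)
qed

lemma cbanach_X: "cbanach_subspace X"
  by (simp add: cbanach_subspace_def csubspace_X closed_X)

lemma norm_emb_fun:
  assumes "bdd f C"
  shows "cmod (emb_fun f n) \<le> C"
proof -
  have "cmod (\<Sum>k\<in>A. of_real (w j k) * f j k) \<le> C" if "finite A" for A j
  proof -
    have "cmod (\<Sum>k\<in>A. of_real (w j k) * f j k) \<le> (\<Sum>k\<in>A. w j k * cmod (f j k))"
      by (rule sum_norm_le) (simp add: norm_mult w_pos less_imp_le)
    also have "\<dots> \<le> C"
      using assms that by (auto simp: bdd_def intro: seq_bddD2)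
    finally show ?thesis .
  qed
  moreover have "cmod (f j k) \<le> C" for j k
    using assms by (auto simp: bdd_def intro: seq_bddD1)
  ultimately show ?thesis
    by (auto simp: emb_fun_def split: prod.split sum.split)
qed

lemma emb_apply: "bdd f C \<Longrightarrow> apply_bcontfun (emb f) n = emb_fun f n"
  unfolding emb_def using norm_emb_fun in_bcontfun_nat_iff by (subst Bcontfun_inverse) blast+

lemma coord_emb: "bdd f C \<Longrightarrow> coord (emb f) = f"
  by (simp add: coord_def emb_apply fun_eq_iff) (simp add: emb_fun_def)

lemma emb_in_X: "bdd f C \<Longrightarrow> emb f \<in> X"
  by (auto simp: X_def coord_emb emb_apply)

lemma norm_emb: "bdd f C \<Longrightarrow> norm (emb f) \<le> C"
  by (rule norm_bound) (simp add: emb_apply norm_emb_fun)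

lemma norm_coord: "cmod (coord x j k) \<le> norm x"
  by (simp add: coord_def norm_bounded)

text \<open>The weighted subset sums are themselves entries of \<open>x\<close>, hence at most
  \<open>norm x\<close>. With \<open>norm_emb\<close> this makes the sup norm on \<open>X\<close>
  equivalent to the block norm, up to the factor 4.\<close>

lemma bdd_coord:
  assumes "x \<in> X"
  shows "bdd (coord x) (4 * norm x)"
  unfolding bdd_def
proof (intro allI seq_bddI)
  fix j k
  show "cmod (coord x j k) \<le> 4 * norm x"
    using norm_coord[of x j k] norm_ge_zero[of x] by linarith
next
  fix j and A :: "nat set"
  assume "finite A"
  have "cmod (\<Sum>k\<in>B. of_real (w j k) * coord x j k) \<le> norm x" if "B \<subseteq> A" for B
  proof -
    have "finite B"
      using \<open>finite A\<close> that finite_subset by blast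
    then have "(\<Sum>k\<in>B. of_real (w j k) * coord x j k)
        = emb_fun (coord x) (prod_encode (j, sum_encode (Inr (set_encode B))))"
      by (simp add: emb_fun_def)
    also have "\<dots> = apply_bcontfun x (prod_encode (j, sum_encode (Inr (set_encode B))))"
      using assms by (simp add: X_def)
    finally show ?thesis
      by (simp add: norm_bounded)
  qed
  from sum_cmod_le_subset_sums[OF \<open>finite A\<close> this]
  show "(\<Sum>k\<in>A. w j k * cmod (coord x j k)) \<le> 4 * norm x"
    using less_imp_le[OF w_pos] by (simp add: norm_mult)
qed

section \<open>Operators on \<open>X\<close> induced by operators on arrays\<close>

definition lift :: "((nat \<Rightarrow> nat \<Rightarrow> complex) \<Rightarrow> nat \<Rightarrow> nat \<Rightarrow> complex) \<Rightarrow> linf \<Rightarrow> linf" where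
  "lift U x = emb (U (coord x))"

text \<open>Linearity is asked on bounded arrays only, since the Neumann series to be lifted later
  need convergence. The bound \<open>K\<close> refers to the block norm; passing to the norm of
  \<open>X\<close> costs a factor 4.\<close>

definition bdd_linear :: "((nat \<Rightarrow> nat \<Rightarrow> complex) \<Rightarrow> nat \<Rightarrow> nat \<Rightarrow> complex) \<Rightarrow> real \<Rightarrow> bool" where
  "bdd_linear U K \<longleftrightarrow> (\<forall>f C. bdd f C \<longrightarrow> bdd (U f) (K * C))
    \<and> (\<forall>f g C D c d. bdd f C \<longrightarrow> bdd g D \<longrightarrow>
          U (\<lambda>j k. c * f j k + d * g j k) = (\<lambda>j k. c * U f j k + d * U g j k))"

lemma bdd_linear_lincomb:
  assumes "bdd_linear U K" "bdd f C" "bdd g D"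
  shows "U (\<lambda>j k. c * f j k + d * g j k) = (\<lambda>j k. c * U f j k + d * U g j k)"
  using assms unfolding bdd_linear_def by blast

lemma bdd_linear_bdd:
  "bdd_linear U K \<Longrightarrow> x \<in> X \<Longrightarrow> bdd (U (coord x)) (K * (4 * norm x))"
  using bdd_coord by (auto simp: bdd_linear_def)

lemma
  assumes "bdd_linear U K" "x \<in> X"
  shows lift_in_X: "lift U x \<in> X"
    and coord_lift: "coord (lift U x) = U (coord x)"
    and norm_lift: "norm (lift U x) \<le> 4 * K * norm x"
  using emb_in_X[OF bdd_linear_bdd[OF assms]] coord_emb[OF bdd_linear_bdd[OF assms]]
    norm_emb[OF bdd_linear_bdd[OF assms]]
  by (simp_all add: lift_def mult_ac)

lemma bounded_op_lift:
  assumes "bdd_linear U K"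
  shows "bounded_op X (lift U)"
proof -
  have "lift U (x + y) = lift U x + lift U y" if "x \<in> X" "y \<in> X" for x y
    using bdd_linear_lincomb[OF assms bdd_coord[OF that(1)] bdd_coord[OF that(2)], of 1 1] that
    by (intro X_eqI) (auto simp: coord_lift[OF assms] lift_in_X[OF assms] X_add)
  moreover have "lift U (cscale c x) = cscale c (lift U x)" if "x \<in> X" for c x
    using bdd_linear_lincomb[OF assms bdd_coord[OF that] bdd_coord[OF that], of c 0] that
    by (intro X_eqI) (auto simp: coord_lift[OF assms] lift_in_X[OF assms] X_cscale)
  ultimately show ?thesis
    unfolding bounded_op_def using lift_in_X[OF assms] norm_lift[OF assms] by blast
qed

lemma opnorm_le:
  assumes "\<And>x. x \<in> X \<Longrightarrow> norm (A x) \<le> B * norm x" "0 \<le> B"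
  shows "opnorm X A \<le> B"
  unfolding opnorm_def
proof (rule cSup_least)
  show "(\<lambda>x. norm (A x)) ` {x \<in> X. norm x \<le> 1} \<noteq> {}"
    using X_0 by (auto intro: exI[of _ 0])
  fix b assume "b \<in> (\<lambda>x. norm (A x)) ` {x \<in> X. norm x \<le> 1}"
  then obtain x where "x \<in> X" "norm x \<le> 1" "b = norm (A x)"
    by blast
  then show "b \<le> B"
    using assms(1)[of x] mult_left_mono[of "norm x" 1 B] assms(2) by linarith
qed

text \<open>\<open>opnorm\<close> is a supremum of reals, so an a priori bound \<open>B\<close> is
  supplied to make the set bounded above.\<close>

lemma le_opnorm:
  assumes "\<And>x. x \<in> X \<Longrightarrow> norm (A x) \<le> B * norm x" "0 \<le> B" "x \<in> X" "norm x \<le> 1"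
  shows "norm (A x) \<le> opnorm X A"
  unfolding opnorm_def
proof (rule cSup_upper)
  show "bdd_above ((\<lambda>x. norm (A x)) ` {x \<in> X. norm x \<le> 1})"
  proof (rule bdd_aboveI)
    fix b assume "b \<in> (\<lambda>x. norm (A x)) ` {x \<in> X. norm x \<le> 1}"
    then obtain x where "x \<in> X" "norm x \<le> 1" "b = norm (A x)"
      by blast
    then show "b \<le> B"
      using assms(1)[of x] mult_left_mono[of "norm x" 1 B] assms(2) by linarith
  qed
qed (use assms in auto)

lemma is_inverse_on_lift:
  assumes "bdd_linear U K" "bdd_linear V K'"
    and "\<And>f C. bdd f C \<Longrightarrow> V (\<lambda>j k. z * f j k - U f j k) = f"
    and "\<And>f C. bdd f C \<Longrightarrow> (\<lambda>j k. z * V f j k - U (V f) j k) = f"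
  shows "is_inverse_on X (lam_minus z (lift U)) (lift V)"
  unfolding is_inverse_on_def
proof (intro conjI ballI bounded_op_lift[OF assms(2)])
  fix x assume x: "x \<in> X"
  have A: "lam_minus z (lift U) y \<in> X" if "y \<in> X" for y
    using that by (auto simp: lam_minus_def intro!: X_diff X_cscale lift_in_X[OF assms(1)])
  show "lift V (lam_minus z (lift U) x) = x"
    by (rule X_eqI)
      (use x assms(3)[OF bdd_coord[OF x]] in
        \<open>auto simp: coord_lift[OF assms(2)] lift_in_X[OF assms(2)] A\<close>,
       auto simp: lam_minus_def coord_lift[OF assms(1)])
  have "coord (lam_minus z (lift U) (lift V x)) = coord x"
    using x assms(4)[OF bdd_coord[OF x]]
    by (auto simp: lam_minus_def coord_lift[OF assms(2)] coord_lift[OF assms(1)] lift_in_X[OF assms(2)])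
  then show "lam_minus z (lift U) (lift V x) = x"
    by (intro X_eqI) (auto simp: x A lift_in_X[OF assms(2)])
qed

text \<open>The choice in \<open>resolvent\<close> fixes nothing outside \<open>X\<close>, but on
  \<open>X\<close> a left inverse applied to \<open>x = A (S x)\<close> must return
  \<open>S x\<close>.\<close>

lemma resolvent_eq:
  assumes "is_inverse_on X (lam_minus z T) S" "x \<in> X"
  shows "resolvent X T z x = S x"
proof -
  have R: "is_inverse_on X (lam_minus z T) (resolvent X T z)"
    unfolding resolvent_def by (rule someI[where P = "is_inverse_on X (lam_minus z T)", OF assms(1)])
  have "S x \<in> X"
    using assms by (auto simp: is_inverse_on_def bounded_op_def)
  then show ?thesis
    using R assms unfolding is_inverse_on_def by metis
qed

end

section \<open>Shift series in a single block\<close>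

lemma seq_bdd_lincomb:
  assumes "seq_bdd w f C" "seq_bdd w g D" "\<And>k. 0 \<le> w k"
  shows "seq_bdd w (\<lambda>k. a * f k + b * g k) (cmod a * C + cmod b * D)"
proof (rule seq_bddI)
  fix k
  have "cmod (a * f k + b * g k) \<le> cmod a * cmod (f k) + cmod b * cmod (g k)"
    by (metis norm_mult norm_triangle_ineq)
  also have "\<dots> \<le> cmod a * C + cmod b * D"
    using assms by (intro add_mono mult_left_mono) (auto intro: seq_bddD1)
  finally show "cmod (a * f k + b * g k) \<le> cmod a * C + cmod b * D" .
next
  fix A :: "nat set" assume "finite A"
  have "(\<Sum>k\<in>A. w k * cmod (a * f k + b * g k))
      \<le> (\<Sum>k\<in>A. cmod a * (w k * cmod (f k)) + cmod b * (w k * cmod (g k)))"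
  proof (rule sum_mono)
    fix k
    have "cmod (a * f k + b * g k) \<le> cmod a * cmod (f k) + cmod b * cmod (g k)"
      by (metis norm_mult norm_triangle_ineq)
    from mult_left_mono[OF this assms(3)[of k]]
    show "w k * cmod (a * f k + b * g k) \<le> cmod a * (w k * cmod (f k)) + cmod b * (w k * cmod (g k))"
      by (simp add: algebra_simps)
  qed
  also have "\<dots> = cmod a * (\<Sum>k\<in>A. w k * cmod (f k)) + cmod b * (\<Sum>k\<in>A. w k * cmod (g k))"
    by (simp add: sum.distrib sum_distrib_left)
  also have "\<dots> \<le> cmod a * C + cmod b * D"
    using assms \<open>finite A\<close> by (intro add_mono mult_left_mono) (auto intro: seq_bddD2)
  finally show "(\<Sum>k\<in>A. w k * cmod (a * f k + b * g k)) \<le> cmod a * C + cmod b * D" .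
qed

text \<open>Interchange of the finite sum and the series: the i-th shift contributes at most
  \<open>e i\<close> to the weighted sum. The sup part is a separate assumption because the two
  applications bound it by different means.\<close>

lemma seq_bdd_series:
  assumes "\<And>k. 0 \<le> w k"
    and summable: "\<And>k. summable (\<lambda>i. cmod (c i) * cmod (f (k + i)))"
    and "\<And>k. (\<Sum>i. cmod (c i) * cmod (f (k + i))) \<le> D"
    and le: "\<And>A i. finite A \<Longrightarrow> cmod (c i) * (\<Sum>k\<in>A. w k * cmod (f (k + i))) \<le> e i"
    and "summable e" "suminf e \<le> D"
  shows "seq_bdd w (\<lambda>k. \<Sum>i. c i * f (k + i)) D"
proof (rule seq_bddI)
  have norm_le: "cmod (\<Sum>i. c i * f (k + i)) \<le> (\<Sum>i. cmod (c i) * cmod (f (k + i)))" for k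
    using summable_norm[of "\<lambda>i. c i * f (k + i)"] summable by (simp add: norm_mult)
  then show "cmod (\<Sum>i. c i * f (k + i)) \<le> D" for k
    using assms(3) order_trans by blast
  fix A :: "nat set" assume A: "finite A"
  have "(\<Sum>k\<in>A. w k * cmod (\<Sum>i. c i * f (k + i)))
      \<le> (\<Sum>k\<in>A. w k * (\<Sum>i. cmod (c i) * cmod (f (k + i))))"
    by (intro sum_mono mult_left_mono norm_le assms(1))
  also have "\<dots> = (\<Sum>k\<in>A. \<Sum>i. w k * (cmod (c i) * cmod (f (k + i))))"
    by (intro sum.cong refl suminf_mult [symmetric] summable)
  also have "\<dots> = (\<Sum>i. \<Sum>k\<in>A. w k * (cmod (c i) * cmod (f (k + i))))"
    by (intro suminf_sum [symmetric] summable_mult summable)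
  also have "\<dots> \<le> suminf e"
    using le[OF A]
    by (intro suminf_le assms(5) summable_sum summable_mult summable)
      (auto simp: sum_distrib_left mult_ac)
  also have "\<dots> \<le> D"
    by (rule assms(6))
  finally show "(\<Sum>k\<in>A. w k * cmod (\<Sum>i. c i * f (k + i))) \<le> D" .
qed

text \<open>The growth rate \<open>1 / L\<close> makes every left shift gain a factor
  \<open>exp (- 1 / L)\<close>, while the small initial weight \<open>1 / L\<close> leaves room for
  long windows of norm 1.\<close>

definition exp_weight :: "real \<Rightarrow> nat \<Rightarrow> real" where
  "exp_weight L k = exp (real k / L) / L"

context
  fixes L :: real
  assumes L: "0 < L"
begin

lemma exp_weight_pos: "0 < exp_weight L k"
  using L by (simp add: exp_weight_def)

lemma exp_weight_ge: "1 / L \<le> exp_weight L k"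
  using L by (simp add: exp_weight_def divide_right_mono)

lemma seq_bdd_exp_weight_shift_sum:
  assumes "seq_bdd (exp_weight L) f C" "finite A"
  shows "(\<Sum>k\<in>A. exp_weight L k * cmod (f (k + i))) \<le> exp (- 1 / L) ^ i * C"
proof -
  have "exp (- 1 / L) ^ i = exp (- (real i / L))"
    by (simp flip: exp_of_nat_mult)
  then have "exp (- 1 / L) ^ i * exp_weight L (k + i) = exp_weight L k" for k
    by (simp add: exp_weight_def add_divide_distrib flip: exp_add)
  then have "(\<Sum>k\<in>A. exp_weight L k * cmod (f (k + i)))
      = exp (- 1 / L) ^ i * (\<Sum>k\<in>A. exp_weight L (k + i) * cmod (f (k + i)))"
    by (simp add: sum_distrib_left flip: mult.assoc)
  also have "(\<Sum>k\<in>A. exp_weight L (k + i) * cmod (f (k + i)))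
      = (\<Sum>k\<in>(\<lambda>k. k + i) ` A. exp_weight L k * cmod (f k))"
    by (simp add: sum.reindex)
  also have "\<dots> \<le> C"
    using assms by (intro seq_bddD2) auto
  finally show ?thesis
    by (simp add: mult_left_mono)
qed

lemma seq_bdd_exp_weight_Suc:
  assumes "seq_bdd (exp_weight L) f C"
  shows "seq_bdd (exp_weight L) (\<lambda>k. f (Suc k)) C"
proof (rule seq_bddI)
  show "cmod (f (Suc k)) \<le> C" for k
    using assms by (rule seq_bddD1)
  fix A :: "nat set" assume "finite A"
  from seq_bdd_exp_weight_shift_sum[OF assms this, of 1]
  have "(\<Sum>k\<in>A. exp_weight L k * cmod (f (Suc k))) \<le> exp (- 1 / L) * C"
    by simp
  also have "\<dots> \<le> 1 * C"
    using L seq_bdd_nonneg[OF assms] by (intro mult_right_mono) auto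
  finally show "(\<Sum>k\<in>A. exp_weight L k * cmod (f (Suc k))) \<le> C"
    by simp
qed

lemma
  assumes "seq_bdd (exp_weight L) f C"
  shows summable_exp_weight: "summable (\<lambda>i. cmod (f (k + i)))"
    and suminf_exp_weight_le: "(\<Sum>i. cmod (f (k + i))) \<le> L * C"
proof -
  have *: "(\<Sum>i<n. cmod (f (k + i))) \<le> L * C" for n
  proof -
    have "1 \<le> L * exp_weight L i" for i
      using exp_weight_ge[of i] L by (simp add: field_simps)
    from mult_right_mono[OF this norm_ge_zero]
    have "(\<Sum>i<n. cmod (f (k + i))) \<le> (\<Sum>i<n. L * (exp_weight L (k + i) * cmod (f (k + i))))"
      by (intro sum_mono) (simp add: mult.assoc)
    also have "\<dots> = L * (\<Sum>i\<in>(\<lambda>i. k + i) ` {..<n}. exp_weight L i * cmod (f i))"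
      by (simp add: sum.reindex sum_distrib_left)
    also have "\<dots> \<le> L * C"
      using L assms by (intro mult_left_mono seq_bddD2) auto
    finally show ?thesis .
  qed
  then show "summable (\<lambda>i. cmod (f (k + i)))"
    by (intro bounded_imp_summable[of _ "L * C"]) (auto simp flip: lessThan_Suc_atMost simp del: sum.lessThan_Suc)
  then show "(\<Sum>i. cmod (f (k + i))) \<le> L * C"
    using * by (rule suminf_le_const)
qed

text \<open>The coefficients need not decay: the sup part is controlled by the unweighted l1 norm,
  at most \<open>L * C\<close>, and the weighted part by the geometric series with ratio
  \<open>exp (- 1 / L)\<close>.\<close>

lemma
  assumes f: "seq_bdd (exp_weight L) f C" and c: "\<And>i. cmod (c i) \<le> b"
  shows summable_bdd_coeffs: "summable (\<lambda>i. cmod (c i) * cmod (f (k + i)))"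
    and seq_bdd_bdd_coeffs: "seq_bdd (exp_weight L) (\<lambda>k. \<Sum>i. c i * f (k + i)) (b * (L + 1) * C)"
proof -
  have b: "0 \<le> b"
    using c[of 0] norm_ge_zero[of "c 0"] by linarith
  have C: "0 \<le> C"
    using f by (rule seq_bdd_nonneg)
  show S: "summable (\<lambda>i. cmod (c i) * cmod (f (k + i)))" for k
    by (rule summable_comparison_test'[OF summable_mult[OF summable_exp_weight[OF f, of k], of b], where N = 0])
      (simp add: mult_right_mono c)
  define r where "r = exp (- 1 / L)"
  have r: "0 \<le> r" "r < 1"
    using L by (auto simp: r_def)
  \<comment> \<open>This says that \<open>r\<close> is at most \<open>L / (L + 1)\<close>, which
    bounds the sum of the geometric series.\<close>
  have "1 + 1 / L \<le> exp (1 / L)"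
    by (rule exp_ge_add_one_self)
  then have r2: "1 / (1 - r) \<le> L + 1"
    using L r by (simp add: r_def exp_minus field_simps)
  show "seq_bdd (exp_weight L) (\<lambda>k. \<Sum>i. c i * f (k + i)) (b * (L + 1) * C)"
  proof (rule seq_bdd_series[OF less_imp_le[OF exp_weight_pos] S])
    fix k
    have "(\<Sum>i. cmod (c i) * cmod (f (k + i))) \<le> (\<Sum>i. b * cmod (f (k + i)))"
      by (intro suminf_le S summable_mult summable_exp_weight[OF f] mult_right_mono c) auto
    also have "\<dots> = b * (\<Sum>i. cmod (f (k + i)))"
      by (intro suminf_mult summable_exp_weight[OF f])
    also have "\<dots> \<le> b * (L * C)"
      by (intro mult_left_mono suminf_exp_weight_le[OF f] b)
    also have "\<dots> \<le> b * (L + 1) * C"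
      using b C by (simp add: algebra_simps)
    finally show "(\<Sum>i. cmod (c i) * cmod (f (k + i))) \<le> b * (L + 1) * C" .
  next
    fix A :: "nat set" and i assume "finite A"
    from seq_bdd_exp_weight_shift_sum[OF f this, of i]
    show "cmod (c i) * (\<Sum>k\<in>A. exp_weight L k * cmod (f (k + i))) \<le> b * (r ^ i * C)"
      unfolding r_def using b c less_imp_le[OF exp_weight_pos]
      by (intro mult_mono) (auto intro!: sum_nonneg)
  next
    have "(\<lambda>i. b * (r ^ i * C)) sums (b * (1 / (1 - r) * C))"
      using r by (intro sums_mult sums_mult2 geometric_sums) auto
    then show "summable (\<lambda>i. b * (r ^ i * C))" "(\<Sum>i. b * (r ^ i * C)) \<le> b * (L + 1) * C"
      using mult_left_mono[OF mult_right_mono[OF r2 C] b]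
      by (auto simp: sums_iff mult_ac)
  qed
qed

text \<open>With decaying coefficients it suffices that shifts are contractions, so the bound is
  free of \<open>L\<close>. Blocks far from the spectral parameter need exactly this.\<close>

lemma seq_bdd_geometric_coeffs:
  assumes f: "seq_bdd (exp_weight L) f C" and c: "\<And>i. cmod (c i) \<le> b * r ^ i"
    and r: "0 \<le> r" "r < 1"
  shows "seq_bdd (exp_weight L) (\<lambda>k. \<Sum>i. c i * f (k + i)) (b / (1 - r) * C)"
proof -
  have b: "0 \<le> b"
    using c[of 0] norm_ge_zero[of "c 0"] by (simp del: norm_ge_zero)
  have C: "0 \<le> C"
    using f by (rule seq_bdd_nonneg)
  have "r ^ i \<le> 1" for i
    using r by (simp add: power_le_one)
  then have c': "cmod (c i) \<le> b" for i
    using c[of i] mult_left_mono[of "r ^ i" 1 b] b by fastforce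
  note S = summable_bdd_coeffs[OF f c']
  have geo: "(\<lambda>i. b * r ^ i * C) sums (b / (1 - r) * C)"
    using sums_mult2[OF sums_mult[OF geometric_sums[of r], of b], of C] r by simp
  show ?thesis
  proof (rule seq_bdd_series[OF less_imp_le[OF exp_weight_pos] S])
    fix k
    have "(\<Sum>i. cmod (c i) * cmod (f (k + i))) \<le> (\<Sum>i. b * r ^ i * C)"
      using geo b r seq_bddD1[OF f]
      by (intro suminf_le S mult_mono c) (auto simp: sums_iff)
    then show "(\<Sum>i. cmod (c i) * cmod (f (k + i))) \<le> b / (1 - r) * C"
      using geo by (simp add: sums_iff)
  next
    fix A :: "nat set" and i assume A: "finite A"
    have "exp (- 1 / L) ^ i * C \<le> 1 * C"
      using L C by (intro mult_right_mono power_le_one) auto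
    with seq_bdd_exp_weight_shift_sum[OF f A, of i]
    have "(\<Sum>k\<in>A. exp_weight L k * cmod (f (k + i))) \<le> C"
      by linarith
    then show "cmod (c i) * (\<Sum>k\<in>A. exp_weight L k * cmod (f (k + i))) \<le> b * r ^ i * C"
      using b c r less_imp_le[OF exp_weight_pos]
      by (intro mult_mono) (auto intro!: sum_nonneg)
  qed (use geo in \<open>auto simp: sums_iff\<close>)
qed

end

text \<open>The Neumann series of \<open>(\<nu> - q \<Lambda>)\<^sup>-\<^sup>1\<close>, \<open>\<Lambda>\<close> being the left shift.\<close>

definition neumann :: "complex \<Rightarrow> complex \<Rightarrow> (nat \<Rightarrow> complex) \<Rightarrow> nat \<Rightarrow> complex" where
  "neumann q \<nu> f k = (\<Sum>i. q ^ i / \<nu> ^ Suc i * f (k + i))"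

context
  fixes L :: real and q \<nu> :: complex
  assumes L: "0 < L" and \<nu>: "\<nu> \<noteq> 0" and q: "cmod q \<le> cmod \<nu>"
begin

lemma neumann_coeff_le: "cmod (q ^ i / \<nu> ^ Suc i) \<le> 1 / cmod \<nu>"
proof -
  have "cmod (q ^ i / \<nu> ^ Suc i) = (cmod q / cmod \<nu>) ^ i * (1 / cmod \<nu>)"
    by (simp add: norm_divide norm_power norm_mult power_divide)
  also have "\<dots> \<le> 1 * (1 / cmod \<nu>)"
    using \<nu> q by (intro mult_right_mono power_le_one) auto
  finally show ?thesis
    by simp
qed

lemma summable_neumann:
  assumes "seq_bdd (exp_weight L) f C"
  shows "summable (\<lambda>i. q ^ i / \<nu> ^ Suc i * f (k + i))"
proof (rule summable_norm_cancel)
  show "summable (\<lambda>i. cmod (q ^ i / \<nu> ^ Suc i * f (k + i)))"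
    unfolding norm_mult [of "_ / _"] by (rule summable_bdd_coeffs[OF L assms neumann_coeff_le])
qed

lemma neumann_lincomb:
  assumes "seq_bdd (exp_weight L) f C" "seq_bdd (exp_weight L) g D"
  shows "neumann q \<nu> (\<lambda>k. c * f k + d * g k) k = c * neumann q \<nu> f k + d * neumann q \<nu> g k"
proof -
  have "(\<lambda>i. c * (q ^ i / \<nu> ^ Suc i * f (k + i)) + d * (q ^ i / \<nu> ^ Suc i * g (k + i)))
      sums (c * neumann q \<nu> f k + d * neumann q \<nu> g k)"
    unfolding neumann_def
    by (intro sums_add sums_mult summable_sums summable_neumann[OF assms(1)] summable_neumann[OF assms(2)])
  moreover have "c * (q ^ i / \<nu> ^ Suc i * f (k + i)) + d * (q ^ i / \<nu> ^ Suc i * g (k + i))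
      = q ^ i / \<nu> ^ Suc i * (c * f (k + i) + d * g (k + i))" for i
    by (simp only: distrib_left mult_ac)
  ultimately show ?thesis
    by (simp add: neumann_def sums_iff)
qed

text \<open>Without its first term the series at \<open>k\<close> is \<open>q / \<nu>\<close> times
  the series at \<open>Suc k\<close>.\<close>

lemma neumann_eq:
  assumes "seq_bdd (exp_weight L) f C"
  shows "\<nu> * neumann q \<nu> f k - q * neumann q \<nu> f (Suc k) = f k"
proof -
  let ?a = "\<lambda>i. q ^ i / \<nu> ^ Suc i * f (k + i)"
  have "neumann q \<nu> f k = ?a 0 + (\<Sum>i. ?a (Suc i))"
    unfolding neumann_def using suminf_split_head[OF summable_neumann[OF assms, of k]] by simp
  also have "(\<Sum>i. ?a (Suc i)) = (\<Sum>i. q / \<nu> * (q ^ i / \<nu> ^ Suc i * f (Suc k + i)))"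
    by (simp add: mult.assoc)
  also have "\<dots> = q / \<nu> * neumann q \<nu> f (Suc k)"
    unfolding neumann_def by (intro suminf_mult summable_neumann[OF assms])
  finally show ?thesis
    using \<nu> by (simp add: field_simps)
qed

lemma seq_bdd_neumann:
  assumes "seq_bdd (exp_weight L) f C"
  shows "seq_bdd (exp_weight L) (neumann q \<nu> f) ((L + 1) / cmod \<nu> * C)"
  using seq_bdd_bdd_coeffs[OF L assms neumann_coeff_le] by (simp add: neumann_def[abs_def])

lemma seq_bdd_neumann_far:
  assumes "seq_bdd (exp_weight L) f C" "2 * cmod q \<le> cmod \<nu>"
  shows "seq_bdd (exp_weight L) (neumann q \<nu> f) (2 / cmod \<nu> * C)"
proof -
  have "cmod (q ^ i / \<nu> ^ Suc i) \<le> 1 / cmod \<nu> * (1 / 2) ^ i" for i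
  proof -
    have "cmod (q ^ i / \<nu> ^ Suc i) = 1 / cmod \<nu> * (cmod q / cmod \<nu>) ^ i"
      by (simp add: norm_divide norm_power norm_mult power_divide)
    also have "\<dots> \<le> 1 / cmod \<nu> * (1 / 2) ^ i"
      using \<nu> assms(2) by (intro mult_left_mono power_mono) (auto simp: field_simps)
    finally show ?thesis .
  qed
  from seq_bdd_geometric_coeffs[OF L assms(1) this] show ?thesis
    by (simp add: neumann_def[abs_def])
qed

end

section \<open>The lazy shift\<close>

definition lazy :: "real \<Rightarrow> (nat \<Rightarrow> real) \<Rightarrow> nat \<Rightarrow> real" where
  "lazy p f k = (1 - p) * f k + p * f (Suc k)"

lemma lazy_power_mono:
  assumes "0 \<le> p" "p \<le> 1" "\<And>k. f k \<le> g k"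
  shows "(lazy p ^^ n) f k \<le> (lazy p ^^ n) g k"
proof (induction n arbitrary: k)
  case (Suc n)
  then show ?case
    using assms(1,2) by (auto simp: lazy_def intro!: add_mono mult_left_mono)
qed (simp add: assms)

lemma lazy_power_const: "(lazy p ^^ n) (\<lambda>k. a) = (\<lambda>k. a)"
proof (induction n)
  case (Suc n)
  show ?case
    unfolding funpow.simps o_apply Suc.IH by (auto simp: lazy_def fun_eq_iff algebra_simps)
qed simp

text \<open>\<open>lazy p\<close> averages over one step of a walk moving right with probability \<open>p\<close>, so this is the
  second moment of a binomial distribution.\<close>

lemma lazy_power_quadratic:
  "(lazy p ^^ n) (\<lambda>k. a - b * (real k - c)\<^sup>2)
    = (\<lambda>k. a - b * ((real k + n * p - c)\<^sup>2 + n * p * (1 - p)))"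
proof (induction n)
  case (Suc n)
  show ?case
    unfolding funpow.simps o_apply Suc.IH
    by (auto simp: lazy_def fun_eq_iff power2_eq_square algebra_simps)
qed simp

text \<open>The subtraction is truncated, so a window reaching below 0 is cut off there.\<close>

definition bump :: "nat \<Rightarrow> nat \<Rightarrow> nat \<Rightarrow> real" where
  "bump c r k = (if k \<in> {c - r..c + r} then 1 else 0)"

lemma lazy_power_bump_bounds:
  assumes "0 \<le> p" "p \<le> 1"
  shows "0 \<le> (lazy p ^^ n) (bump c r) k" "(lazy p ^^ n) (bump c r) k \<le> 1"
proof -
  have "0 \<le> bump c r i" "bump c r i \<le> 1" for i
    by (simp_all add: bump_def)
  from lazy_power_mono[OF assms, where f = "\<lambda>k. 0" and g = "bump c r", OF this(1)]
    lazy_power_mono[OF assms, where f = "bump c r" and g = "\<lambda>k. 1", OF this(2)]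
  show "0 \<le> (lazy p ^^ n) (bump c r) k" "(lazy p ^^ n) (bump c r) k \<le> 1"
    unfolding lazy_power_const by blast+
qed

text \<open>Chebyshev's inequality through a quadratic minorant of the window, to which monotonicity
  and the exact second moment apply. The squared bias is at most 1 and the variance at most
  \<open>n * p\<close>, so the choice of \<open>r\<close> limits the loss to 1/4.\<close>

lemma lazy_power_bump_ge:
  assumes p: "0 \<le> p" "p \<le> 1" and r: "0 < r" "4 * (n * p + 1) \<le> (real r)\<^sup>2"
    and c: "\<bar>n * p - real c\<bar> \<le> 1"
  shows "3 / 4 \<le> (lazy p ^^ n) (bump c r) 0"
proof -
  let ?b = "1 / (real r)\<^sup>2"
  have "1 - ?b * (real k - c)\<^sup>2 \<le> bump c r k" for k
  proof (cases "k \<in> {c - r..c + r}")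
    case False
    then have "real r \<le> \<bar>real k - c\<bar>"
      by auto
    then have "(real r)\<^sup>2 \<le> (real k - c)\<^sup>2"
      using power_mono[of "real r" "\<bar>real k - c\<bar>" 2] by simp
    then show ?thesis
      using False r by (simp add: bump_def field_simps)
  qed (simp add: bump_def)
  from lazy_power_mono[OF p, where f = "\<lambda>k. 1 - ?b * (real k - c)\<^sup>2" and g = "bump c r", OF this]
  have "1 - ?b * ((n * p - c)\<^sup>2 + n * p * (1 - p)) \<le> (lazy p ^^ n) (bump c r) 0"
    unfolding lazy_power_quadratic by (metis add_0 of_nat_0)
  moreover have "?b * ((n * p - c)\<^sup>2 + n * p * (1 - p)) \<le> ?b * (1 + n * p)"
  proof (intro mult_left_mono add_mono)
    show "(n * p - c)\<^sup>2 \<le> 1"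
      using c by (simp add: abs_square_le_1)
    show "n * p * (1 - p) \<le> n * p"
      using p by (simp add: mult_left_le)
  qed simp
  moreover have "?b * (1 + n * p) \<le> 1 / 4"
    using r by (simp add: field_simps)
  ultimately show ?thesis
    by linarith
qed

text \<open>The window has at most \<open>2 * r + 1\<close> points, and the weight is largest at its
  right end.\<close>

lemma seq_bdd_bump:
  assumes L: "0 < L" and "(2 * real r + 1) * exp (real (c + r) / L) / L \<le> 1"
  shows "seq_bdd (exp_weight L) (\<lambda>k. of_real (bump c r k)) 1"
proof (rule seq_bddI)
  show "cmod (of_real (bump c r k)) \<le> 1" for k
    by (simp add: bump_def)
  fix A :: "nat set" assume "finite A"
  have "(\<Sum>k\<in>A. exp_weight L k * cmod (of_real (bump c r k)))
      = (\<Sum>k\<in>A \<inter> {c - r..c + r}. exp_weight L k)"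
    by (subst sum.inter_restrict[OF \<open>finite A\<close>]) (auto simp: bump_def intro: sum.cong)
  also have "\<dots> \<le> (\<Sum>k\<in>{c - r..c + r}. exp_weight L k)"
    using less_imp_le[OF exp_weight_pos[OF L]] by (intro sum_mono2) auto
  also have "\<dots> \<le> of_nat (card {c - r..c + r}) * (exp (real (c + r) / L) / L)"
    using L by (intro sum_bounded_above) (auto simp: exp_weight_def divide_right_mono)
  also have "\<dots> \<le> (2 * real r + 1) * (exp (real (c + r) / L) / L)"
    using L by (intro mult_right_mono) auto
  also have "\<dots> \<le> 1"
    using assms(2) by simp
  finally show "(\<Sum>k\<in>A. exp_weight L k * cmod (of_real (bump c r k))) \<le> 1" .
qed

section \<open>The operator\<close>

text \<open>The lower bound comes from the imaginary part: on [0,1] the cosine is at least 1/2, as 1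
  < pi/3, so sin s is at least s/2. The upper bound is the chord length 2 |sin (t/2)|.\<close>

lemma cis_minus_one_bounds:
  assumes "\<bar>t\<bar> \<le> 1"
  shows "\<bar>t\<bar> / 2 \<le> cmod (cis t - 1)" "cmod (cis t - 1) \<le> \<bar>t\<bar>"
proof -
  have "s / 2 \<le> sin s" if "0 \<le> s" "s \<le> 1" for s :: real
  proof -
    have "0 / 2 - sin 0 \<ge> s / 2 - sin s"
    proof (rule DERIV_nonpos_imp_nonincreasing[OF that(1)])
      fix x assume x: "0 \<le> x" "x \<le> s"
      have "cos (pi / 3) \<le> cos x"
        using x that pi_gt3 by (intro cos_monotone_0_pi_le) auto
      then have "1 / 2 - cos x \<le> 0"
        by (simp add: cos_60)
      moreover have "((\<lambda>x. x / 2 - sin x) has_real_derivative 1 / 2 - cos x) (at x)"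
        by (auto intro!: derivative_eq_intros)
      ultimately show "\<exists>y. ((\<lambda>x. x / 2 - sin x) has_real_derivative y) (at x) \<and> y \<le> 0"
        by blast
    qed
    then show ?thesis
      by simp
  qed
  from this[of "\<bar>t\<bar>"] assms have "\<bar>t\<bar> / 2 \<le> \<bar>sin t\<bar>"
    by (cases "0 \<le> t") auto
  also have "\<dots> \<le> cmod (cis t - 1)"
    using abs_Im_le_cmod[of "cis t - 1"] by simp
  finally show "\<bar>t\<bar> / 2 \<le> cmod (cis t - 1)" .
  have "cmod (cis t - 1) = 2 * \<bar>sin (t / 2)\<bar>"
    using dist_exp_i_1[of t] by (simp add: cis_conv_exp)
  then show "cmod (cis t - 1) \<le> \<bar>t\<bar>"
    using abs_sin_x_le_abs_x[of "t / 2"] by simp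
qed

locale lazy_shift_family =
  fixes \<alpha> :: real
  assumes \<alpha>: "2 < \<alpha>"
begin

definition \<theta> :: "nat \<Rightarrow> real" where "\<theta> j = exp (- real j)"
definition L :: "nat \<Rightarrow> real" where "L j = exp ((\<alpha> - 1) * real j)"
definition q :: "nat \<Rightarrow> complex" where "q j = cis (\<theta> j) * of_real (\<theta> j / 10)"
text \<open>An eigenvalue of the block: the left shift kills the unit vector at coordinate
  0.\<close>

definition ev :: "nat \<Rightarrow> complex" where "ev j = cis (\<theta> j) * of_real (1 - \<theta> j / 10)"

lemma \<theta>_pos: "0 < \<theta> j" and \<theta>_le_1: "\<theta> j \<le> 1"
  by (simp_all add: \<theta>_def)

lemma L_ge_1: "1 \<le> L j"
  using \<alpha> by (simp add: L_def)

lemma L_pos: "0 < L j"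
  using L_ge_1[of j] by linarith

sublocale weighted_blocks "\<lambda>j. exp_weight (L j)"
  by unfold_locales (rule exp_weight_pos[OF L_pos])

definition U :: "(nat \<Rightarrow> nat \<Rightarrow> complex) \<Rightarrow> nat \<Rightarrow> nat \<Rightarrow> complex" where
  "U f j k = ev j * f j k + q j * f j (Suc k)"

definition V :: "complex \<Rightarrow> (nat \<Rightarrow> nat \<Rightarrow> complex) \<Rightarrow> nat \<Rightarrow> nat \<Rightarrow> complex" where
  "V z f j k = neumann (q j) (z - ev j) (f j) k"

lemma norm_q: "cmod (q j) = \<theta> j / 10"
  using \<theta>_pos[of j] by (simp add: q_def norm_mult)

lemma norm_ev: "cmod (ev j) = 1 - \<theta> j / 10"
proof -
  have "cmod (ev j) = \<bar>1 - \<theta> j / 10\<bar>"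
    unfolding ev_def norm_mult norm_cis norm_of_real by simp
  then show ?thesis
    using \<theta>_le_1[of j] by simp
qed

lemma norm_one_minus_ev: "cmod (1 - ev j) \<le> 11 / 10 * \<theta> j"
proof -
  have "cmod (1 - ev j) \<le> cmod (1 - cis (\<theta> j)) + cmod (cis (\<theta> j) - ev j)"
    using norm_triangle_ineq[of "1 - cis (\<theta> j)" "cis (\<theta> j) - ev j"] by simp
  also have "cis (\<theta> j) - ev j = q j"
    by (simp add: ev_def q_def algebra_simps)
  finally show ?thesis
    using cis_minus_one_bounds(2)[of "\<theta> j"] \<theta>_pos[of j] \<theta>_le_1[of j]
    by (simp add: norm_q norm_minus_commute)
qed

text \<open>The moduli of \<open>ev j\<close> and \<open>q j\<close> add up to 1, and the left shift
  is a contraction for the block norm.\<close>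

lemma bdd_U:
  assumes "bdd f C"
  shows "bdd (U f) C"
  unfolding bdd_def
proof
  fix j
  have f: "seq_bdd (exp_weight (L j)) (f j) C"
    using assms by (simp add: bdd_def)
  from seq_bdd_lincomb[OF f seq_bdd_exp_weight_Suc[OF L_pos f] less_imp_le[OF exp_weight_pos[OF L_pos]],
      where a = "ev j" and b = "q j"]
  show "seq_bdd (exp_weight (L j)) (U f j) C"
    by (simp add: U_def[abs_def] norm_q norm_ev algebra_simps)
qed

lemma bdd_linear_U: "bdd_linear U 1"
  by (auto simp: bdd_linear_def bdd_U U_def fun_eq_iff algebra_simps)

lemma bdd_U_power: "bdd f C \<Longrightarrow> bdd ((U ^^ n) f) C"
  by (induction n) (auto simp: bdd_U)

lemma U_power_diff: "(U ^^ n) (\<lambda>j k. f j k - g j k) = (\<lambda>j k. (U ^^ n) f j k - (U ^^ n) g j k)"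
proof (induction n)
  case (Suc n)
  show ?case
    unfolding funpow.simps o_apply Suc.IH by (auto simp: U_def fun_eq_iff algebra_simps)
qed simp

abbreviation T :: "linf \<Rightarrow> linf" where "T \<equiv> lift U"

lemma T_in_X: "x \<in> X \<Longrightarrow> T x \<in> X"
  and coord_T: "x \<in> X \<Longrightarrow> coord (T x) = U (coord x)"
  using lift_in_X[OF bdd_linear_U] coord_lift[OF bdd_linear_U] by auto

lemma T_power:
  assumes "x \<in> X"
  shows "(T ^^ n) x \<in> X \<and> coord ((T ^^ n) x) = (U ^^ n) (coord x)"
  by (induction n) (auto simp: assms T_in_X coord_T)

text \<open>Taking powers at the level of arrays, where \<open>U\<close> is a contraction, pays the
  factor 4 between the norms once instead of n times.\<close>

lemma norm_T_power:
  assumes "x \<in> X"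
  shows "norm ((T ^^ n) x) \<le> 4 * norm x"
proof -
  have "(T ^^ n) x = emb ((U ^^ n) (coord x))"
    using T_power[OF assms, of n] emb_in_X[OF bdd_U_power[OF bdd_coord[OF assms]]]
      coord_emb[OF bdd_U_power[OF bdd_coord[OF assms]]]
    by (intro X_eqI) simp_all
  then show ?thesis
    using norm_emb[OF bdd_U_power[OF bdd_coord[OF assms]]] by simp
qed

lemma power_bounded_T: "power_bounded X T"
  unfolding power_bounded_def
proof (intro exI[of _ 4] allI)
  show "opnorm X (T ^^ n) \<le> 4" for n
    by (intro opnorm_le norm_T_power) auto
qed

section \<open>The resolvent on the unit circle\<close>

context
  fixes z :: complex
  assumes z: "cmod z = 1" "z \<noteq> 1"
begin

lemma norm_z_minus_ev: "\<theta> j / 10 \<le> cmod (z - ev j)"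
  using norm_triangle_ineq2[of z "ev j"] z by (simp add: norm_ev)

lemma q_le_z_minus_ev: "cmod (q j) \<le> cmod (z - ev j)" and z_minus_ev_nz: "z - ev j \<noteq> 0"
  using norm_z_minus_ev[of j] \<theta>_pos[of j] by (auto simp: norm_q)

text \<open>The right inverse property is \<open>neumann_eq\<close>. The left one follows from it by
  linearity, because the Neumann series commutes with the shift.\<close>

lemma is_inverse_on_V_step:
  assumes "bdd f C"
  shows "V z (\<lambda>j k. z * f j k - U f j k) = f" "(\<lambda>j k. z * V z f j k - U (V z f) j k) = f"
proof -
  have f: "seq_bdd (exp_weight (L j)) (f j) C" for j
    using assms by (simp add: bdd_def)
  note n = L_pos z_minus_ev_nz q_le_z_minus_ev
  have eq: "(z - ev j) * V z f j k - q j * V z f j (Suc k) = f j k" for j k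
    unfolding V_def by (rule neumann_eq[OF n f])
  then show "(\<lambda>j k. z * V z f j k - U (V z f) j k) = f"
    by (auto simp: U_def fun_eq_iff algebra_simps)
  have "V z (\<lambda>j k. z * f j k - U f j k) j k
      = neumann (q j) (z - ev j) (\<lambda>k. (z - ev j) * f j k + (- q j) * f j (Suc k)) k" for j k
    by (simp add: V_def U_def algebra_simps)
  also have "neumann (q j) (z - ev j) (\<lambda>k. (z - ev j) * f j k + (- q j) * f j (Suc k)) k = f j k" for j k
    unfolding neumann_lincomb[OF n f seq_bdd_exp_weight_Suc[OF L_pos f]]
    using eq[of j k] by (simp add: V_def neumann_def)
  finally show "V z (\<lambda>j k. z * f j k - U f j k) = f"
    by (simp add: fun_eq_iff)
qed

text \<open>Blocks with \<open>\<theta> j\<close> at least half of \<open>cmod (z - 1)\<close> use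
  the bound involving \<open>L\<close>; for the others the Neumann ratio is at most 1/2 and the
  bound without \<open>L\<close> applies.\<close>

lemma seq_bdd_V:
  assumes f: "seq_bdd (exp_weight (L j)) (f j) C"
  shows "seq_bdd (exp_weight (L j)) (V z f j) (20 * (cmod (z - 1) / 2) powr - \<alpha> * C)"
proof -
  note n = L_pos z_minus_ev_nz q_le_z_minus_ev
  define d where "d = cmod (z - 1)"
  have d: "0 < d" "d \<le> 2"
    using z norm_triangle_ineq4[of z 1] by (auto simp: d_def)
  have C: "0 \<le> C"
    using f by (rule seq_bdd_nonneg)
  have \<nu>: "0 < cmod (z - ev j)"
    using z_minus_ev_nz by simp
  have V: "V z f j = neumann (q j) (z - ev j) (f j)"
    by (simp add: V_def fun_eq_iff)
  have "\<exists>K. seq_bdd (exp_weight (L j)) (V z f j) (K * C) \<and> K \<le> 20 * (d / 2) powr - \<alpha>"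
  proof (cases "d \<le> 2 * \<theta> j")
    case True
    \<comment> \<open>\<open>L / \<theta> = \<theta>\<^sup>-\<^sup>\<alpha>\<close>\<close>
    have "(L j + 1) / cmod (z - ev j) \<le> (L j + 1) / (\<theta> j / 10)"
      using norm_z_minus_ev[of j] \<theta>_pos[of j] L_pos[of j] \<nu> by (intro divide_left_mono) auto
    also have "\<dots> \<le> (2 * L j) / (\<theta> j / 10)"
      using L_ge_1[of j] \<theta>_pos[of j] by (intro divide_right_mono) auto
    also have "\<dots> = 20 * \<theta> j powr - \<alpha>"
      by (simp add: \<theta>_def L_def powr_def field_simps flip: exp_add)
    also have "\<dots> \<le> 20 * (d / 2) powr - \<alpha>"
      using True d \<alpha> by (intro mult_left_mono powr_mono2') auto
    finally show ?thesis
      using seq_bdd_neumann[OF n f] unfolding V by blast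
  next
    case False
    have "d \<le> cmod (z - ev j) + cmod (1 - ev j)"
      using norm_triangle_ineq4[of "z - ev j" "1 - ev j"] by (simp add: d_def)
    \<comment> \<open>Here \<open>\<theta> j < d / 2\<close>, so \<open>1 - ev j\<close> has modulus
      below \<open>11 / 20 * d\<close>, which leaves \<open>9 / 20 * d\<close>.\<close>
    with norm_one_minus_ev[of j] have *: "d * (9 / 20) \<le> cmod (z - ev j)" "2 * (\<theta> j / 10) \<le> cmod (z - ev j)"
      using False \<theta>_pos[of j] by linarith+
    have "2 / cmod (z - ev j) \<le> 2 / (d * (9 / 20))"
      using * d \<nu> by (intro divide_left_mono) auto
    also have "\<dots> \<le> 20 * (d / 2) powr - 1"
      using d by (simp add: powr_minus field_simps)
    \<comment> \<open>Since \<open>d / 2\<close> is at most 1, lowering the exponent from -1 to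
      \<open>- \<alpha>\<close> only enlarges the power.\<close>
    also have "\<dots> \<le> 20 * (d / 2) powr - \<alpha>"
      using d \<alpha> by (intro mult_left_mono powr_mono') auto
    finally show ?thesis
      using seq_bdd_neumann_far[OF n f] *(2) unfolding V norm_q by blast
  qed
  then show ?thesis
    using C unfolding d_def by (meson mult_right_mono seq_bdd_mono)
qed

lemma bdd_linear_V: "bdd_linear (V z) (20 * (cmod (z - 1) / 2) powr - \<alpha>)"
  unfolding bdd_linear_def
proof (intro conjI allI impI)
  show "bdd (V z f) (20 * (cmod (z - 1) / 2) powr - \<alpha> * C)" if "bdd f C" for f C
    using that unfolding bdd_def by (blast intro: seq_bdd_V)
  show "V z (\<lambda>j k. c * f j k + d * g j k) = (\<lambda>j k. c * V z f j k + d * V z g j k)"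
    if "bdd f C" "bdd g D" for f g C D c d
    using that unfolding V_def bdd_def fun_eq_iff
    by (blast intro: neumann_lincomb[OF L_pos z_minus_ev_nz q_le_z_minus_ev])
qed

lemma is_inverse_on_V: "is_inverse_on X (lam_minus z T) (lift (V z))"
  by (rule is_inverse_on_lift[OF bdd_linear_U bdd_linear_V is_inverse_on_V_step])

lemma opnorm_resolvent:
  "0 \<le> opnorm X (resolvent X T z)"
  "opnorm X (resolvent X T z) \<le> 80 * (cmod (z - 1) / 2) powr - \<alpha>"
proof -
  have *: "norm (resolvent X T z x) \<le> 80 * (cmod (z - 1) / 2) powr - \<alpha> * norm x" if "x \<in> X" for x
    using norm_lift[OF bdd_linear_V that] resolvent_eq[OF is_inverse_on_V that] by simp
  show "opnorm X (resolvent X T z) \<le> 80 * (cmod (z - 1) / 2) powr - \<alpha>"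
    using * by (intro opnorm_le) auto
  have "norm (resolvent X T z 0) \<le> opnorm X (resolvent X T z)"
    using * by (rule le_opnorm) (auto simp: X_0)
  then show "0 \<le> opnorm X (resolvent X T z)"
    using norm_ge_zero order_trans by blast
qed

end

section \<open>Arrays supported in one block, and the spectrum on the circle\<close>

definition single :: "nat \<Rightarrow> (nat \<Rightarrow> real) \<Rightarrow> nat \<Rightarrow> nat \<Rightarrow> complex" where
  "single J g j k = (if j = J then of_real (g k) else 0)"

lemma bdd_single:
  assumes "seq_bdd (exp_weight (L J)) (\<lambda>k. of_real (g k)) C"
  shows "bdd (single J g) C"
  unfolding bdd_def
proof
  fix j
  show "seq_bdd (exp_weight (L j)) (single J g j) C"
  proof (cases "j = J")
    case False
    then show ?thesis
      using seq_bdd_nonneg[OF assms] by (simp add: single_def[abs_def] seq_bdd_def)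
  qed (use assms in \<open>simp add: single_def[abs_def]\<close>)
qed

lemma U_power_single:
  "(U ^^ n) (single J g) J k = cis (\<theta> J) ^ n * of_real ((lazy (\<theta> J / 10) ^^ n) g k)"
proof (induction n arbitrary: k)
  case (Suc n)
  then show ?case
    by (simp add: U_def lazy_def ev_def q_def algebra_simps)
qed (simp add: single_def)

text \<open>The eigenvalues \<open>ev j\<close> tend to 1. The eigenvector \<open>bump 0 0\<close>
  in block \<open>j\<close> forces any bound \<open>K\<close> of an inverse to satisfy
  \<open>1 \<le> cmod (1 - ev j) * K\<close>, which fails for large \<open>j\<close>.\<close>

lemma one_in_spectrum: "1 \<in> spectrum_on X T"
proof (rule ccontr)
  assume "1 \<notin> spectrum_on X T"
  then obtain S where S: "is_inverse_on X (lam_minus 1 T) S"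
    by (auto simp: spectrum_on_def invertible_on_def)
  then obtain K where K: "\<forall>x\<in>X. norm (S x) \<le> K * norm x"
    by (auto simp: is_inverse_on_def bounded_op_def)
  have "1 \<le> 11 / 10 * \<theta> j * \<bar>K\<bar>" for j
  proof -
    let ?f = "single j (bump 0 0)"
    have "seq_bdd (exp_weight (L j)) (\<lambda>k. of_real (bump 0 0 k)) 1"
      using L_ge_1[of j] by (intro seq_bdd_bump) auto
    then have f: "bdd ?f 1"
      by (rule bdd_single)
    let ?x = "emb ?f"
    have x: "?x \<in> X" "coord ?x = ?f"
      using f by (auto intro: emb_in_X coord_emb)
    have "lam_minus 1 T ?x = cscale (1 - ev j) ?x"
    proof (rule X_eqI)
      show "coord (lam_minus 1 T ?x) = coord (cscale (1 - ev j) ?x)"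
      proof (intro ext)
        fix i k
        show "coord (lam_minus 1 T ?x) i k = coord (cscale (1 - ev j) ?x) i k"
          using x by (simp add: lam_minus_def coord_T U_def single_def bump_def algebra_simps)
      qed
    qed (auto simp: lam_minus_def intro!: X_diff X_cscale T_in_X x)
    then have "?x = cscale (1 - ev j) (S ?x)"
      using S x(1) unfolding is_inverse_on_def bounded_op_def by metis
    then have "norm ?x \<le> cmod (1 - ev j) * norm (S ?x)"
      using norm_cscale[of "1 - ev j" "S ?x"] by simp
    also have "\<dots> \<le> cmod (1 - ev j) * (K * norm ?x)"
      using K x(1) by (intro mult_left_mono) auto
    finally have "1 * norm ?x \<le> (cmod (1 - ev j) * K) * norm ?x"
      by simp
    moreover have "1 \<le> norm ?x"
      using norm_coord[of ?x j 0] by (simp add: x single_def bump_def)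
    ultimately have "1 \<le> cmod (1 - ev j) * K"
      by (intro mult_right_le_imp_le[of 1 "norm ?x"]) auto
    also have "\<dots> \<le> 11 / 10 * \<theta> j * \<bar>K\<bar>"
    proof -
      have "cmod (1 - ev j) * K \<le> cmod (1 - ev j) * \<bar>K\<bar>"
        by (intro mult_left_mono) auto
      also have "\<dots> \<le> 11 / 10 * \<theta> j * \<bar>K\<bar>"
        using norm_one_minus_ev[of j] by (intro mult_right_mono) auto
      finally show ?thesis .
    qed
    finally show ?thesis .
  qed
  moreover have "(\<lambda>j. 11 / 10 * \<theta> j * \<bar>K\<bar>) \<longlonglongrightarrow> 0"
    unfolding \<theta>_def by real_asymp
  ultimately have "1 \<le> (0::real)"
    by (intro LIMSEQ_le_const) blast+
  then show False
    by simp
qed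

lemma spectrum_T: "spectrum_on X T \<inter> {z. cmod z = 1} = {1}"
  using one_in_spectrum is_inverse_on_V by (auto simp: spectrum_on_def invertible_on_def)

lemma resolvent_bigo:
  "(\<lambda>t. opnorm X (resolvent X T (cis t))) \<in> O[at 0](\<lambda>t. \<bar>t\<bar> powr - \<alpha>)"
proof (rule bigoI)
  have "\<forall>\<^sub>F t in at 0. t \<noteq> 0 \<and> \<bar>t\<bar> \<le> (1::real)"
    by (auto simp: eventually_at dist_real_def intro!: exI[of _ 1])
  then show "\<forall>\<^sub>F t in at 0. norm (opnorm X (resolvent X T (cis t)))
      \<le> 80 * (1 / 4) powr - \<alpha> * norm (\<bar>t\<bar> powr - \<alpha>)"
  proof eventually_elim
    case (elim t)
    then have b: "\<bar>t\<bar> / 2 \<le> cmod (cis t - 1)"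
      by (intro cis_minus_one_bounds) auto
    with elim have z: "cmod (cis t) = 1" "cis t \<noteq> 1"
      by auto
    \<comment> \<open>One factor 1/2 comes from the chord estimate, the other from the resolvent
      bound; the negative exponent reverses the inequality.\<close>
    have "(cmod (cis t - 1) / 2) powr - \<alpha> \<le> (1 / 4 * \<bar>t\<bar>) powr - \<alpha>"
      using b elim \<alpha> by (intro powr_mono2') auto
    also have "\<dots> = (1 / 4) powr - \<alpha> * \<bar>t\<bar> powr - \<alpha>"
      by (intro powr_mult)
    finally show ?case
      using opnorm_resolvent[OF z] by simp
  qed
qed

section \<open>The lower bound for \<open>T ^^ n\<close> composed with \<open>I - T\<close>\<close>

lemma opnorm_ge:
  assumes "seq_bdd (exp_weight (L J)) (\<lambda>k. of_real (bump c r k)) 1"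
    and r: "0 < r" "4 * (n * (\<theta> J / 10) + 1) \<le> (real r)\<^sup>2"
    and c: "\<bar>n * (\<theta> J / 10) - real c\<bar> \<le> 1"
  shows "\<theta> J / 4 \<le> opnorm X ((T ^^ n) \<circ> (\<lambda>x. x - T x))"
proof -
  define p where "p = \<theta> J / 10"
  have p: "0 \<le> p" "p \<le> 1"
    using \<theta>_pos[of J] \<theta>_le_1[of J] by (auto simp: p_def)
  define f where "f = single J (bump c r)"
  have f: "bdd f 1"
    unfolding f_def using assms(1) by (rule bdd_single)
  define x where "x = emb f"
  have x: "x \<in> X" "coord x = f" "norm x \<le> 1"
    unfolding x_def using f by (auto intro: emb_in_X coord_emb norm_emb)
  define a where "a = (lazy p ^^ n) (bump c r) 0"
  define b where "b = (lazy p ^^ Suc n) (bump c r) 0"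
  have a: "3 / 4 \<le> a" "a \<le> 1"
    using lazy_power_bump_ge[OF p r[folded p_def] c[folded p_def]] lazy_power_bump_bounds[OF p]
    by (simp_all add: a_def)
  define a' where "a' = (lazy p ^^ n) (bump c r) 1"
  have a': "0 \<le> a'" "a' \<le> 1"
    using lazy_power_bump_bounds[OF p] by (simp_all add: a'_def)
  have "a - b = p * (a - a')"
    by (simp add: a_def a'_def b_def lazy_def algebra_simps)
  moreover have "\<bar>a - a'\<bar> \<le> 1"
    using a a' by auto
  ultimately have ab: "\<bar>a - b\<bar> \<le> p"
    using p by (simp add: abs_mult mult_left_le)
  have coord: "cis (\<theta> J) ^ n * (of_real a - cis (\<theta> J) * of_real b) = coord ((T ^^ n) (x - T x)) J 0"
  proof -
    have "coord ((T ^^ n) (x - T x)) J 0 = (U ^^ n) (\<lambda>j k. f j k - U f j k) J 0"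
      using T_power[of "x - T x" n] x by (simp add: X_diff T_in_X coord_T)
    also have "\<dots> = (U ^^ n) f J 0 - (U ^^ Suc n) f J 0"
      by (simp only: U_power_diff funpow_Suc_right o_apply)
    finally show ?thesis
      unfolding f_def U_power_single by (simp only: a_def b_def p_def) (simp add: algebra_simps)
  qed
  \<comment> \<open>One more step of the walk changes the value at 0 by at most
    \<open>p = \<theta> J / 10\<close>, whereas the rotation moves \<open>a\<close> by at least
    \<open>3 / 8 * \<theta> J\<close>. The difference exceeds \<open>\<theta> J / 4\<close>.\<close>
  have "\<theta> J / 2 * (3 / 4) \<le> cmod (cis (\<theta> J) - 1) * a"
    using a \<theta>_pos[of J] \<theta>_le_1[of J] cis_minus_one_bounds(1)[of "\<theta> J"] by (intro mult_mono) auto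
  also have "\<dots> = cmod ((cis (\<theta> J) - 1) * of_real a)"
    using a unfolding norm_mult norm_of_real by simp
  also have "(cis (\<theta> J) - 1) * of_real a = cis (\<theta> J) * of_real (a - b) - (a - cis (\<theta> J) * b)"
    by (simp add: algebra_simps)
  also have "cmod \<dots> \<le> cmod (cis (\<theta> J) * of_real (a - b)) + cmod (a - cis (\<theta> J) * b)"
    by (rule norm_triangle_ineq4)
  also have "cmod (cis (\<theta> J) * of_real (a - b)) = \<bar>a - b\<bar>"
    by (simp only: norm_mult norm_cis norm_of_real mult_1)
  finally have "\<theta> J / 4 \<le> cmod (a - cis (\<theta> J) * b)"
    using ab \<theta>_pos[of J] unfolding p_def by linarith
  also have "\<dots> = cmod (cis (\<theta> J) ^ n * (of_real a - cis (\<theta> J) * of_real b))"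
    by (simp add: norm_mult norm_power)
  also have "\<dots> = cmod (coord ((T ^^ n) (x - T x)) J 0)"
    by (simp only: coord)
  also have "\<dots> \<le> norm (((T ^^ n) \<circ> (\<lambda>x. x - T x)) x)"
    by (simp add: norm_coord)
  \<comment> \<open>The constant 20 = 4 * (1 + 4) only serves as the a priori bound for the
    supremum.\<close>
  also have "\<dots> \<le> opnorm X ((T ^^ n) \<circ> (\<lambda>x. x - T x))"
  proof (rule le_opnorm[where B = 20])
    fix y assume y: "y \<in> X"
    have "norm ((T ^^ n) (y - T y)) \<le> 4 * norm (y - T y)"
      using y by (intro norm_T_power X_diff T_in_X)
    also have "\<dots> \<le> 4 * (norm y + 4 * norm y)"
      using norm_triangle_ineq4[of y "T y"] norm_T_power[OF y, of 1] by simp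
    finally show "norm (((T ^^ n) \<circ> (\<lambda>x. x - T x)) y) \<le> 20 * norm y"
      by simp
  qed (use x in auto)
  finally show ?thesis .
qed

text \<open>With \<open>n = N j\<close> the walk has mean \<open>n p \<le> j L/10\<close>, where the weight is at most \<open>e\<^bsup>j/10\<^esup> / L \<le> L\<^bsup>1/10 - 1\<^esup>\<close>.\<close>

definition N :: "nat \<Rightarrow> nat" where "N j = nat \<lfloor>real j * exp (\<alpha> * real j)\<rfloor>"

lemma L_at_top: "filterlim L at_top sequentially"
  using \<alpha> unfolding L_def by real_asymp

lemma eventually_opnorm_ge:
  "\<forall>\<^sub>F j in sequentially. \<theta> j / 4 \<le> opnorm X ((T ^^ N j) \<circ> (\<lambda>x. x - T x))"
proof -
  \<comment> \<open>\<open>\<rho> (L j)\<close> dominates the window radius, the final 1 absorbing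
    the ceiling. The expression below is of order \<open>L powr (1 / 2 + 1 / 10 - 1)\<close> up to a
    logarithmic factor, so it tends to 0.\<close>
  define \<rho> :: "real \<Rightarrow> real" where "\<rho> l = 2 * sqrt (l * ln l / 10 + 1) + 1" for l
  have "\<forall>\<^sub>F l in at_top. (2 * \<rho> l + 1) * exp ((l * ln l / 10 + \<rho> l) / l) / l \<le> 1"
    unfolding \<rho>_def by real_asymp
  from eventually_compose_filterlim[OF this L_at_top]
  have "\<forall>\<^sub>F j in sequentially.
      (2 * \<rho> (L j) + 1) * exp ((L j * ln (L j) / 10 + \<rho> (L j)) / L j) / L j \<le> 1" .
  then show ?thesis
  proof eventually_elim
    case (elim j)
    define m where "m = N j * (\<theta> j / 10)"
    have m0: "0 \<le> m"
      using \<theta>_pos[of j] by (simp add: m_def)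
    have "real (N j) \<le> real j * exp (\<alpha> * real j)"
      unfolding N_def by (rule of_nat_floor) simp
    then have "m \<le> real j * exp (\<alpha> * real j) * (\<theta> j / 10)"
      unfolding m_def using \<theta>_pos[of j] by (intro mult_right_mono) auto
    also have "\<dots> = L j * real j / 10"
      by (simp add: \<theta>_def L_def algebra_simps flip: exp_add)
    also have "\<dots> \<le> L j * ln (L j) / 10"
    proof -
      have "1 * real j \<le> (\<alpha> - 1) * real j"
        using \<alpha> by (intro mult_right_mono) auto
      then have "real j \<le> ln (L j)"
        by (simp add: L_def)
      then show ?thesis
        using L_pos[of j] by simp
    qed
    finally have m: "m \<le> L j * ln (L j) / 10" .
    \<comment> \<open>Centre within 1 of the mean \<open>m\<close> and radius at least
      \<open>2 * sqrt (m + 1)\<close>, as Chebyshev's inequality requires.\<close>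
    define c where "c = nat \<lfloor>m\<rfloor>"
    define r where "r = nat \<lceil>2 * sqrt (m + 1)\<rceil>"
    have c: "\<bar>m - real c\<bar> \<le> 1" "real c \<le> m"
      using m0 by (auto simp: c_def) linarith+
    have r0: "2 * sqrt (m + 1) \<le> real r"
      unfolding r_def by (rule real_nat_ceiling_ge)
    have "0 < 2 * sqrt (m + 1)"
      using m0 by simp
    with r0 have r1: "0 < r"
      by linarith
    have "(2 * sqrt (m + 1))\<^sup>2 \<le> (real r)\<^sup>2"
      using r0 m0 by (intro power_mono) auto
    then have r2: "4 * (m + 1) \<le> (real r)\<^sup>2"
      using m0 by (simp add: power_mult_distrib)
    have "real r \<le> 2 * sqrt (m + 1) + 1"
      using m0 unfolding r_def by (simp add: of_nat_nat ceiling_correct less_imp_le)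
    also have "\<dots> \<le> \<rho> (L j)"
      using m by (simp add: \<rho>_def)
    finally have r: "real r \<le> \<rho> (L j)" .
    have "(2 * real r + 1) * exp (real (c + r) / L j) / L j
        \<le> (2 * \<rho> (L j) + 1) * exp ((L j * ln (L j) / 10 + \<rho> (L j)) / L j) / L j"
      using r c m L_pos[of j] by (intro divide_right_mono mult_mono) (auto intro!: divide_right_mono)
    with elim have "seq_bdd (exp_weight (L j)) (\<lambda>k. of_real (bump c r k)) 1"
      by (intro seq_bdd_bump L_pos) linarith
    then show ?case
      using r1 r2 c(1) unfolding m_def by (rule opnorm_ge)
  qed
qed

text \<open>The logarithm of \<open>N j\<close> is at most \<open>(\<alpha> + 1) * j\<close>, so it
  cancels the factor \<open>j\<close> in \<open>N j\<close>.\<close>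

lemma eventually_N_ratio_ge:
  "\<forall>\<^sub>F j in sequentially. exp (\<alpha> * real j) / (2 * (\<alpha> + 1)) \<le> real (N j) / ln (real (N j))"
proof -
  have "\<forall>\<^sub>F j in sequentially. (3::real) \<le> real j" "\<forall>\<^sub>F j in sequentially. ln (real j) \<le> real j"
    by real_asymp+
  then show ?thesis
  proof eventually_elim
    case (elim j)
    let ?y = "real j * exp (\<alpha> * real j)"
    \<comment> \<open>From 3 on, the floor keeps at least half of \<open>?y\<close> and exceeds 1,
      so its logarithm is positive.\<close>
    have y: "3 * 1 \<le> ?y"
      using elim \<alpha> by (intro mult_mono) auto
    have N: "?y / 2 \<le> real (N j)" "real (N j) \<le> ?y" "1 < real (N j)"
      using y unfolding N_def by (auto simp: of_nat_floor) linarith+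
    have "ln (real (N j)) \<le> ln ?y"
      using N y by (subst ln_le_cancel_iff) auto
    also have "\<dots> = ln (real j) + \<alpha> * real j"
      using elim by (subst ln_mult) auto
    also have "\<dots> \<le> (\<alpha> + 1) * real j"
      using elim by (simp add: algebra_simps)
    finally have "?y / 2 / ((\<alpha> + 1) * real j) \<le> real (N j) / ln (real (N j))"
      using N elim \<alpha> by (intro frac_le) auto
    moreover have "?y / 2 / ((\<alpha> + 1) * real j) = exp (\<alpha> * real j) / (2 * (\<alpha> + 1))"
    proof -
      have "x * e / 2 / (A * x) = e / (2 * A)" if "x \<noteq> 0" for x e A :: real
        using that by (cases "A = 0") (simp_all add: field_simps)
      then show ?thesis
        using elim by simp
    qed
    ultimately show ?case
      by simp
  qed
qed

text \<open>Along \<open>N j\<close>, which tends to infinity, the lower bound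
  \<open>\<theta> j / 4\<close> meets a factor of at least \<open>exp (real j) / K\<close>. Since
  \<open>\<theta> j * exp (real j) = 1\<close>, the product stays above
  \<open>1 / (4 * K)\<close>.\<close>

lemma limsup_pos:
  "limsup (\<lambda>n. ereal (opnorm X ((T ^^ n) \<circ> (\<lambda>x. x - T x)) * (real n / ln (real n)) powr (1 / \<alpha>))) > 0"
proof -
  define F where "F n = opnorm X ((T ^^ n) \<circ> (\<lambda>x. x - T x)) * (real n / ln (real n)) powr (1 / \<alpha>)" for n
  define K where "K = (2 * (\<alpha> + 1)) powr (1 / \<alpha>)"
  have K: "0 < K"
    using \<alpha> by (simp add: K_def)
  have F: "\<forall>\<^sub>F j in sequentially. 1 / (4 * K) \<le> F (N j)"
    using eventually_opnorm_ge eventually_N_ratio_ge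
  proof eventually_elim
    case (elim j)
    have "exp (real j) / K = (exp (\<alpha> * real j) / (2 * (\<alpha> + 1))) powr (1 / \<alpha>)"
      using \<alpha> by (subst powr_divide) (auto simp: K_def powr_def)
    also have "\<dots> \<le> (real (N j) / ln (real (N j))) powr (1 / \<alpha>)"
      using elim \<alpha> by (intro powr_mono2) auto
    finally have "\<theta> j / 4 * (exp (real j) / K) \<le> F (N j)"
      unfolding F_def using elim \<theta>_pos[of j] K by (intro mult_mono) auto
    then show ?case
      by (simp add: \<theta>_def exp_minus)
  qed
  have N: "filterlim N sequentially sequentially"
  proof -
    \<comment> \<open>The identity is written with a floor so that the comparison with
      \<open>N j\<close> reduces to monotonicity of the floor.\<close>
    have "filterlim (\<lambda>j::nat. nat \<lfloor>real j\<rfloor>) sequentially sequentially"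
      by (simp add: filterlim_ident)
    moreover have "nat \<lfloor>real j\<rfloor> \<le> N j" for j
      unfolding N_def using \<alpha> by (intro nat_mono floor_mono mult_right_le_one_le[THEN order_trans]) (auto simp: mult_le_cancel_left1)
    ultimately show ?thesis
      by (rule filterlim_at_top_mono[OF _ always_eventually[OF allI]])
  qed
  have "ereal (1 / (4 * K)) \<le> limsup (\<lambda>n. ereal (F n))"
  proof (rule ccontr)
    assume "\<not> ?thesis"
    then have "\<forall>\<^sub>F n in sequentially. F n < 1 / (4 * K)"
      by (auto dest!: Limsup_lessD simp: not_le)
    from eventually_compose_filterlim[OF this N]
    have "\<forall>\<^sub>F j in sequentially. F (N j) < 1 / (4 * K)" .
    with F have "\<forall>\<^sub>F j in sequentially. False"
      by eventually_elim simp
    then show False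
      by simp
  qed
  moreover have "0 < ereal (1 / (4 * K))"
    using K by simp
  ultimately show ?thesis
    unfolding F_def by (rule less_le_trans[rotated])
qed

lemma X_nontrivial: "X \<noteq> {0}"
proof -
  let ?f = "single 0 (bump 0 0)"
  have "seq_bdd (exp_weight (L 0)) (\<lambda>k. of_real (bump 0 0 k)) 1"
    using L_ge_1[of 0] by (intro seq_bdd_bump) auto
  then have "bdd ?f 1"
    by (rule bdd_single)
  then have "emb ?f \<in> X" "coord (emb ?f) 0 0 = 1"
    by (auto simp: coord_emb single_def bump_def intro: emb_in_X)
  moreover have "coord 0 0 0 = 0"
    by simp
  ultimately show ?thesis
    by (metis singletonD zero_neq_one)
qed

end

theorem theorem3p6:
  fixes \<alpha> :: real
  assumes "\<alpha> > 2"
  shows "\<exists>X T. cbanach_subspace X \<and> X \<noteq> {0} \<and> bounded_op X T \<and> power_bounded X T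
    \<and> spectrum_on X T \<inter> {z. cmod z = 1} = {1}
    \<and> (\<lambda>\<theta>::real. opnorm X (resolvent X T (cis \<theta>))) \<in> O[at 0](\<lambda>\<theta>. \<bar>\<theta>\<bar> powr (-\<alpha>))
    \<and> limsup (\<lambda>n::nat. ereal (opnorm X ((T ^^ n) \<circ> (\<lambda>x. x - T x))
                                  * (real n / ln (real n)) powr (1 / \<alpha>))) > 0"
proof -
  interpret lazy_shift_family \<alpha>
    using assms by unfold_locales
  show ?thesis
    using cbanach_X X_nontrivial bounded_op_lift[OF bdd_linear_U] power_bounded_T spectrum_T
      resolvent_bigo limsup_pos
    by blast
qed

end
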